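(* Let $X$ be a real Banach space such that the closed convex hull of the set $\operatorname{ext} B_X$ of extreme points of the closed unit ball $B_X$ has non-empty interior in $X$. Then every convex body $K\subset X$ has the strong Mankiewicz property.
   Context: All normed spaces are real. $B_X$ is the closed unit ball of $X$. A convex subset $K\subset X$ is a convex body if it has non-empty interior in $X$. A convex subset $K$ of a normed space $X$ has the strong Mankiewicz property if for every normed space $Y$, every convex subset $L\subset Y$, and every surjective isometry (distance-preserving map) $T\colon K\to L$, the map $T$ is affine, i.e. $T(tx+(1-t)y)=tT(x)+(1-t)T(y)$ for all $x,y\in K$, $t\in[0,1]$. *)

theory Defs
  imports "HOL-Analysis.Analysis"
begin

definition convex_body :: "'a::real_normed_vector set \<Rightarrow> bool"
  where "convex_body K \<longleftrightarrow> convex K \<and> interior K \<noteq> {}"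

definition isometry_onto ::
    "('a::metric_space \<Rightarrow> 'b::metric_space) \<Rightarrow> 'a set \<Rightarrow> 'b set \<Rightarrow> bool"
  where "isometry_onto T K L \<longleftrightarrow>
    (\<forall>x\<in>K. \<forall>y\<in>K. dist (T x) (T y) = dist x y) \<and> T ` K = L"

definition affine_map_on ::
    "('a::real_vector \<Rightarrow> 'b::real_vector) \<Rightarrow> 'a set \<Rightarrow> bool"
  where "affine_map_on T K \<longleftrightarrow>
    (\<forall>x\<in>K. \<forall>y\<in>K. \<forall>t\<in>{0..1::real}.
      T (t *\<^sub>R x + (1 - t) *\<^sub>R y) = t *\<^sub>R T x + (1 - t) *\<^sub>R T y)"

text \<open>A definition in HOL cannot quantify over types, so the target normed space is passed
  as a type argument. The strong Mankiewicz property of \<open>K\<close> is the statement that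
  \<open>strong_mankiewicz TYPE('b) K\<close> holds for every normed space \<open>'b\<close>; in a theorem, a type
  variable \<open>'b\<close> that occurs nowhere else is universally quantified and expresses exactly this.\<close>

definition strong_mankiewicz ::
    "'b::real_normed_vector itself \<Rightarrow> 'a::real_normed_vector set \<Rightarrow> bool"
  where "strong_mankiewicz (_ :: 'b itself) K \<longleftrightarrow>
    (\<forall>(L :: 'b set) (T :: 'a \<Rightarrow> 'b).
      convex L \<and> isometry_onto T K L \<longrightarrow> affine_map_on T K)"

end

theory Submission
  imports Defs
begin

text \<open>
  Call \<open>u\<close> straight if \<open>q\<close> is the only point at distance \<open>\<parallel>u\<parallel>\<close> from both \<open>q + u\<close> and \<open>q - u\<close>.
  Multiples of extreme points of the unit ball are straight. The proof draws two consequences for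
  an isometry \<open>T\<close> from \<open>K\<close> onto a convex set \<open>L\<close>, by the same device: produce a point of \<open>L\<close> by
  averaging two values of \<open>T\<close>, pull it back to \<open>K\<close>, and recognise the preimage by its distances to
  \<open>q + u\<close> and \<open>q - u\<close>.

  \<^item> \<open>T\<close> preserves midpoints of segments in a straight direction
    (\<open>isometry_onto_midpoint\<close>): the average of the end values is equidistant from them.

  \<^item> The increment of \<open>T\<close> along a straight \<open>w\<close> does not change when the base point
    moves along a straight \<open>u\<close> (\<open>isometry_onto_parallelogram\<close>). Midpoint preservation in both
    directions makes \<open>T\<close> biaffine on the corners, edge midpoints and centre of the parallelogram with
    corners \<open>q \<plusminus> u \<plusminus> w\<close>, so the only obstruction is its mixed difference \<open>d\<close>. Averaging two opposite corners shows \<open>T q + d \<in> L\<close>, and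
    the distances of \<open>T q + d\<close> to \<open>T (q + u)\<close> and \<open>T (q - u)\<close> equal half the lengths of the
    two sides in direction \<open>u\<close>, that is \<open>\<parallel>u\<parallel>\<close>. Hence the preimage of \<open>T q + d\<close> is \<open>q\<close> and \<open>d = 0\<close>.

  By induction, \<open>T\<close> preserves all sufficiently short midpoints in a direction \<open>h\<close> from the span of the
  straight vectors. On a segment in the interior of \<open>K\<close> with such a direction, the lengths that are
  short enough can be chosen uniformly, so that \<open>T\<close> is affine there. If the closed convex hull of the
  extreme points has an interior point, their span is dense; as \<open>T\<close> is continuous and the interior of
  \<open>K\<close> is dense in \<open>K\<close>, affinity extends to all segments in \<open>K\<close>.
\<close>

section \<open>Straight vectors\<close>

text \<open>
  Only differences of points matter, so uniqueness of the metric midpoint is expressed at the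
  origin: \<open>v\<close> is the deviation of a competing midpoint from the algebraic one.
\<close>

definition straight :: "'a::real_normed_vector \<Rightarrow> bool"
  where "straight u \<longleftrightarrow> (\<forall>v. norm (u + v) = norm u \<and> norm (u - v) = norm u \<longrightarrow> v = 0)"

lemma straightD: "straight u \<Longrightarrow> norm (u + v) = norm u \<Longrightarrow> norm (u - v) = norm u \<Longrightarrow> v = 0"
  by (simp add: straight_def)

text \<open>
  If \<open>e + v\<close> and \<open>e - v\<close> are as long as \<open>e\<close>, both lie in the unit ball and \<open>e\<close> is their midpoint, so
  extremality makes them coincide.
\<close>

lemma straight_extreme_point:
  fixes e :: "'a::real_normed_vector"
  assumes "e extreme_point_of cball 0 1"
  shows "straight e"
  unfolding straight_def
proof (intro allI impI, elim conjE)
  fix v assume v: "norm (e + v) = norm e" "norm (e - v) = norm e"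
  have e: "norm e \<le> 1" and no: "e \<notin> open_segment (e + v) (e - v)"
    using assms v by (auto simp: extreme_point_of_def)
  show "v = 0"
  proof (rule ccontr)
    assume "v \<noteq> 0"
    have "e = midpoint (e + v) (e - v)"
      by (simp add: midpoint_def scaleR_2[symmetric])
    moreover have "e + v \<noteq> e - v"
    proof
      assume "e + v = e - v"
      then have "2 *\<^sub>R v = 0" by (simp add: scaleR_2 algebra_simps)
      with \<open>v \<noteq> 0\<close> show False by simp
    qed
    ultimately show False using no by (metis midpoint_in_open_segment)
  qed
qed

lemma straight_scaleR:
  assumes "straight u"
  shows "straight (c *\<^sub>R u)"
proof (cases "c = 0")
  case False
  show ?thesis
    unfolding straight_def
  proof (intro allI impI, elim conjE)
    fix v assume v: "norm (c *\<^sub>R u + v) = norm (c *\<^sub>R u)" "norm (c *\<^sub>R u - v) = norm (c *\<^sub>R u)"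
    have "c *\<^sub>R u + v = c *\<^sub>R (u + v /\<^sub>R c)" "c *\<^sub>R u - v = c *\<^sub>R (u - v /\<^sub>R c)"
      using False by (simp_all add: algebra_simps)
    with v False have "norm (u + v /\<^sub>R c) = norm u" "norm (u - v /\<^sub>R c) = norm u"
      by simp_all
    then have "v /\<^sub>R c = 0" using assms straightD by blast
    with False show "v = 0" by simp
  qed
qed (simp add: straight_def)

section \<open>Isometries onto convex sets along straight vectors\<close>

lemma isometry_onto_dist:
  "isometry_onto T K L \<Longrightarrow> x \<in> K \<Longrightarrow> y \<in> K \<Longrightarrow> dist (T x) (T y) = dist x y"
  by (simp add: isometry_onto_def)

text \<open>
  Convexity of \<open>L\<close> puts the midpoint of the two outer values into the image of \<open>T\<close>. Its preimage is a
  metric midpoint of \<open>q + u\<close> and \<open>q - u\<close>, and \<open>q\<close> is the only one.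
\<close>

lemma isometry_onto_midpoint:
  fixes T :: "'a::real_normed_vector \<Rightarrow> 'b::real_normed_vector"
  assumes "convex L" and T: "isometry_onto T K L" and u: "straight u"
    and K: "q \<in> K" "q + u \<in> K" "q - u \<in> K"
  shows "T (q + u) + T (q - u) = 2 *\<^sub>R T q"
proof -
  define m where "m = midpoint (T (q + u)) (T (q - u))"
  have "T (q + u) \<in> L" "T (q - u) \<in> L"
    using T K by (auto simp: isometry_onto_def)
  then have "m \<in> L"
    unfolding m_def using \<open>convex L\<close> by (meson convex_contains_segment midpoint_in_closed_segment subsetD)
  then obtain z where z: "z \<in> K" "T z = m"
    using T by (auto simp: isometry_onto_def)
  have d: "dist (T (q + u)) (T (q - u)) = 2 * norm u"
  proof -
    have "(q + u) - (q - u) = 2 *\<^sub>R u" by (simp add: scaleR_2)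
    then show ?thesis
      using isometry_onto_dist[OF T K(2,3)] by (simp add: dist_norm)
  qed
  have "norm (u - (z - q)) = dist (q + u) z"
    by (simp add: dist_norm algebra_simps)
  also have "\<dots> = dist (T (q + u)) m"
    using isometry_onto_dist[OF T K(2) z(1)] z(2) by simp
  also have "\<dots> = norm u" using d by (simp add: m_def dist_midpoint)
  finally have 1: "norm (u - (z - q)) = norm u" .
  have "norm (u + (z - q)) = dist z (q - u)"
    by (simp add: dist_norm algebra_simps)
  also have "\<dots> = dist m (T (q - u))"
    using isometry_onto_dist[OF T z(1) K(3)] z(2) by simp
  also have "\<dots> = norm u" using d by (simp add: m_def dist_midpoint)
  finally have "z - q = 0" using u 1 straightD by blast
  then have "T q = m" using z by simp
  then show ?thesis by (simp add: m_def midpoint_def)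
qed

text \<open>
  Opposite sides have equal increments because the mixed difference \<open>d\<close> vanishes: if
  \<open>T (q + a u + b w) = T q + a B + b C + a b d\<close> at the points with \<open>a\<close> and \<open>b\<close> in \<open>{-1, 0, 1}\<close>, then
  \<open>T q + d\<close> is the average of the values at \<open>a = b = 1\<close> and \<open>a = b = -1\<close>, whereas its differences
  from \<open>T (q + u)\<close> and \<open>T (q - u)\<close> are \<open>d - B\<close> and \<open>d + B\<close>, the increments along \<open>-u\<close> and \<open>u\<close> on the lines
  \<open>b = -1\<close> and \<open>b = 1\<close>.
\<close>

lemma isometry_onto_parallelogram:
  fixes T :: "'a::real_normed_vector \<Rightarrow> 'b::real_normed_vector"
  assumes L: "convex L" and T: "isometry_onto T K L"
    and u: "straight u" and w: "straight w"
    and K: "cball q (norm u + norm w) \<subseteq> K"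
  shows "T (q + u + w) - T (q + u) = T (q + w) - T q"
proof -
  have inK: "q + v \<in> K" if "norm v \<le> norm u + norm w" for v
    using K that by (auto simp: subset_iff dist_norm)
  have uw: "norm (u + w) \<le> norm u + norm w" "norm (u - w) \<le> norm u + norm w"
    "norm (w - u) \<le> norm u + norm w" "norm (- u - w) \<le> norm u + norm w"
    using norm_triangle_ineq[of u w] norm_triangle_ineq4[of u w] norm_triangle_ineq4[of w u]
      norm_triangle_ineq4[of "- u" w] by auto
  have pts: "q \<in> K" "q + u \<in> K" "q - u \<in> K" "q + w \<in> K" "q - w \<in> K"
    "q + u + w \<in> K" "q + u - w \<in> K" "q - u + w \<in> K" "q - u - w \<in> K"
    using inK[of 0] inK[of u] inK[of "- u"] inK[of w] inK[of "- w"]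
      inK[OF uw(1)] inK[OF uw(2)] inK[OF uw(3)] inK[OF uw(4)]
    by (simp_all add: algebra_simps)
  note mid = isometry_onto_midpoint[OF L T]
  have row: "T (q + u) + T (q - u) = 2 *\<^sub>R T q"
    by (intro mid u pts)
  have col: "T (q + w) + T (q - w) = 2 *\<^sub>R T q"
    by (intro mid w pts)
  have right: "T (q + u + w) + T (q + u - w) = 2 *\<^sub>R T (q + u)"
    by (intro mid w pts)
  have left: "T (q - u + w) + T (q - u - w) = 2 *\<^sub>R T (q - u)"
    by (intro mid w pts)
  have top: "T (q + u + w) + T (q - u + w) = 2 *\<^sub>R T (q + w)"
    using mid[OF u, of "q + w"] pts by (simp add: algebra_simps)
  define d where "d = T (q + u + w) - T (q + u) - T (q + w) + T q"
  have "T q + d = midpoint (T (q + u + w)) (T (q - u - w))"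
  proof -
    have a: "T (q - u) = 2 *\<^sub>R T q - T (q + u)"
      and b: "T (q - u + w) = 2 *\<^sub>R T (q + w) - T (q + u + w)"
      and c: "T (q - u - w) = 2 *\<^sub>R T (q - u) - T (q - u + w)"
      using row top left by (simp_all add: eq_diff_eq add.commute)
    have "T (q + u + w) + T (q - u - w) = 2 *\<^sub>R (T q + d)"
      unfolding c b a d_def by (simp add: algebra_simps scaleR_2)
    then show ?thesis by (simp add: midpoint_def)
  qed
  moreover have "T (q + u + w) \<in> L" "T (q - u - w) \<in> L"
    using T pts by (auto simp: isometry_onto_def)
  ultimately have "T q + d \<in> L"
    using L by (metis convex_contains_segment midpoint_in_closed_segment subsetD)
  then obtain z where z: "z \<in> K" "T z = T q + d"
    using T by (auto simp: isometry_onto_def)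
  have "norm (u - (z - q)) = dist (q + u) z"
    by (simp add: dist_norm algebra_simps)
  also have "\<dots> = dist (T (q + u)) (T q + d)"
    using isometry_onto_dist[OF T pts(2) z(1)] z(2) by simp
  also have "\<dots> = dist (T (q + u - w)) (T (q - w))"
  proof -
    have a: "T (q + u - w) = 2 *\<^sub>R T (q + u) - T (q + u + w)"
      and b: "T (q - w) = 2 *\<^sub>R T q - T (q + w)"
      using right col by (simp_all add: eq_diff_eq add.commute)
    show ?thesis
      unfolding dist_norm a b d_def
      by (rule arg_cong[where f = norm]) (simp add: algebra_simps scaleR_2)
  qed
  also have "\<dots> = norm u"
    using isometry_onto_dist[OF T pts(7,5)] by (simp add: dist_norm)
  finally have 1: "norm (u - (z - q)) = norm u" .
  have "norm (u + (z - q)) = dist z (q - u)"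
    by (simp add: dist_norm algebra_simps)
  also have "\<dots> = dist (T q + d) (T (q - u))"
    using isometry_onto_dist[OF T z(1) pts(3)] z(2) by simp
  also have "\<dots> = dist (T (q + u + w)) (T (q + w))"
  proof -
    have a: "T (q - u) = 2 *\<^sub>R T q - T (q + u)"
      using row by (simp add: eq_diff_eq add.commute)
    show ?thesis
      unfolding dist_norm a d_def
      by (rule arg_cong[where f = norm]) (simp add: algebra_simps scaleR_2)
  qed
  also have "\<dots> = norm u"
    using isometry_onto_dist[OF T pts(6,4)] by (simp add: dist_norm)
  finally have "z - q = 0" using u 1 straightD by blast
  then have "d = 0" using z by simp
  then show ?thesis by (simp add: d_def algebra_simps)
qed

text \<open>
  Writing \<open>h\<close> as a combination of straight vectors, one can walk from \<open>p\<close> to \<open>p + t h\<close> in straight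
  steps whose increments are the same as at \<open>p\<close>, and reversing all steps negates all increments. The
  constant \<open>M\<close> bounds the total length of the walk for \<open>t = 1\<close>, which may exceed the norm of \<open>h\<close>; this
  is why only short steps along \<open>h\<close> are controlled at first.
\<close>

lemma isometry_onto_midpoint_span:
  fixes T :: "'a::real_normed_vector \<Rightarrow> 'b::real_normed_vector"
  assumes L: "convex L" and T: "isometry_onto T K L"
    and h: "h \<in> span {u. straight u}"
  obtains M where "M \<ge> 0"
    "\<And>p t. cball p (\<bar>t\<bar> * M) \<subseteq> K \<Longrightarrow> T (p + t *\<^sub>R h) + T (p - t *\<^sub>R h) = 2 *\<^sub>R T p"
proof -
  \<comment> \<open>The induction also needs that shifting the base point by \<open>t h\<close> preserves increments along every
    straight \<open>w\<close>. Since \<open>t\<close> may be negative, this covers the walk in the opposite direction.\<close>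
  have "\<exists>M\<ge>0. norm h \<le> M \<and>
      (\<forall>p t. cball p (\<bar>t\<bar> * M) \<subseteq> K \<longrightarrow> T (p + t *\<^sub>R h) + T (p - t *\<^sub>R h) = 2 *\<^sub>R T p) \<and>
      (\<forall>p t w. straight w \<longrightarrow> cball p (\<bar>t\<bar> * M + norm w) \<subseteq> K \<longrightarrow>
        T (p + t *\<^sub>R h + w) - T (p + t *\<^sub>R h) = T (p + w) - T p)"
    (is "\<exists>M\<ge>0. ?P h M")
    using h
  proof (induction rule: span_induct_alt)
    case base
    show ?case by (intro exI[of _ 0]) (simp add: scaleR_2)
  next
    case (step c u h)
    then obtain M where "M \<ge> 0" and hM: "norm h \<le> M"
      and mid: "\<And>p t. cball p (\<bar>t\<bar> * M) \<subseteq> K \<Longrightarrow> T (p + t *\<^sub>R h) + T (p - t *\<^sub>R h) = 2 *\<^sub>R T p"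
      and par: "\<And>p t w. straight w \<Longrightarrow> cball p (\<bar>t\<bar> * M + norm w) \<subseteq> K \<Longrightarrow>
        T (p + t *\<^sub>R h + w) - T (p + t *\<^sub>R h) = T (p + w) - T p"
      by blast
    define M' where "M' = M + norm (c *\<^sub>R u)"
    have M'0: "M' \<ge> 0" using \<open>M \<ge> 0\<close> by (simp add: M'_def)
    have u: "straight (a *\<^sub>R u)" for a using step by (simp add: straight_scaleR)
    have M't: "\<bar>t\<bar> * M' = \<bar>t\<bar> * M + norm ((t * c) *\<^sub>R u)" for t
      by (simp add: M'_def algebra_simps abs_mult)
    have 1: "norm (c *\<^sub>R u + h) \<le> M'"
      using norm_triangle_ineq[of "c *\<^sub>R u" h] hM by (simp add: M'_def)
    have 2: "T (p + t *\<^sub>R (c *\<^sub>R u + h)) + T (p - t *\<^sub>R (c *\<^sub>R u + h)) = 2 *\<^sub>R T p"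
      if K: "cball p (\<bar>t\<bar> * M') \<subseteq> K" for p t
    proof -
      define v where "v = (t * c) *\<^sub>R u"
      have K': "cball p (\<bar>t\<bar> * M + norm v) \<subseteq> K" using K unfolding M't v_def .
      have a: "T (p + t *\<^sub>R h) + T (p - t *\<^sub>R h) = 2 *\<^sub>R T p"
      proof (rule mid, rule order_trans[OF _ K'])
        show "cball p (\<bar>t\<bar> * M) \<subseteq> cball p (\<bar>t\<bar> * M + norm v)" by (rule subset_cball) simp
      qed
      have b: "T (p + t *\<^sub>R h + v) - T (p + t *\<^sub>R h) = T (p + v) - T p"
        using par[OF _ K'] u by (simp add: v_def)
      have c: "T (p - t *\<^sub>R h - v) - T (p - t *\<^sub>R h) = T (p - v) - T p"
        using par[of "- v" p "- t"] K' u[of "- (t * c)"] by (simp add: v_def)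
      have "norm v \<le> \<bar>t\<bar> * M + norm v" using \<open>M \<ge> 0\<close> by simp
      then have pts: "p \<in> K" "p + v \<in> K" "p - v \<in> K"
        using K' \<open>M \<ge> 0\<close> by (auto simp: subset_iff dist_norm)
      have d: "T (p + v) + T (p - v) = 2 *\<^sub>R T p"
        using isometry_onto_midpoint[OF L T _ pts] u by (simp add: v_def)
      have "T (p + t *\<^sub>R h + v) + T (p - t *\<^sub>R h - v)
          = (T (p + t *\<^sub>R h) + T (p - t *\<^sub>R h)) + (T (p + v) + T (p - v)) - 2 *\<^sub>R T p"
        unfolding b[unfolded diff_eq_eq] c[unfolded diff_eq_eq] scaleR_2 by (simp only: algebra_simps)
      then have "T (p + t *\<^sub>R h + v) + T (p - t *\<^sub>R h - v) = 2 *\<^sub>R T p"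
        unfolding a d by simp
      moreover have "p + t *\<^sub>R (c *\<^sub>R u + h) = p + t *\<^sub>R h + v"
          "p - t *\<^sub>R (c *\<^sub>R u + h) = p - t *\<^sub>R h - v"
        by (simp_all add: v_def algebra_simps)
      ultimately show ?thesis by metis
    qed
    have 3: "T (p + t *\<^sub>R (c *\<^sub>R u + h) + w) - T (p + t *\<^sub>R (c *\<^sub>R u + h)) = T (p + w) - T p"
      if w: "straight w" and K: "cball p (\<bar>t\<bar> * M' + norm w) \<subseteq> K" for p t w
    proof -
      define v where "v = (t * c) *\<^sub>R u"
      define q where "q = p + t *\<^sub>R h"
      have K': "cball p (\<bar>t\<bar> * M + norm v + norm w) \<subseteq> K" using K unfolding M't v_def .
      have pq: "dist p q \<le> \<bar>t\<bar> * M"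
        using hM by (simp add: q_def dist_norm mult_left_mono)
      have "cball q (norm v + norm w) \<subseteq> cball p (\<bar>t\<bar> * M + norm v + norm w)"
      proof
        fix z assume "z \<in> cball q (norm v + norm w)"
        then show "z \<in> cball p (\<bar>t\<bar> * M + norm v + norm w)"
          using pq dist_triangle[of p z q] by simp
      qed
      then have Kq: "cball q (norm v + norm w) \<subseteq> K" using K' by blast
      have "T (q + v + w) - T (q + v) = T (q + w) - T q"
        using isometry_onto_parallelogram[OF L T _ w Kq] u by (simp add: v_def)
      also have "\<dots> = T (p + w) - T p"
        unfolding q_def
      proof (rule par[OF w], rule order_trans[OF _ K'])
        show "cball p (\<bar>t\<bar> * M + norm w) \<subseteq> cball p (\<bar>t\<bar> * M + norm v + norm w)"
          by (rule subset_cball) simp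
      qed
      finally show ?thesis by (simp add: q_def v_def algebra_simps)
    qed
    show ?case using M'0 1 2 3 by blast
  qed
  then show ?thesis using that by blast
qed

section \<open>From short midpoints to affinity on a segment\<close>

lemma arithmetic_progression:
  fixes g :: "nat \<Rightarrow> 'b::real_vector"
  assumes "\<And>k. Suc k < n \<Longrightarrow> g (Suc (Suc k)) + g k = 2 *\<^sub>R g (Suc k)"
    and "k \<le> n"
  shows "g k = g 0 + real k *\<^sub>R (g 1 - g 0)"
  using \<open>k \<le> n\<close>
proof (induction k rule: less_induct)
  case (less k)
  consider "k = 0" | "k = 1" | j where "k = Suc (Suc j)"
    by (metis One_nat_def not0_implies_Suc)
  then show ?case
  proof cases
    case (3 j)
    define D where "D = g 1 - g 0"
    have extrapolate: "2 *\<^sub>R (c + a *\<^sub>R D) - (c + b *\<^sub>R D) = c + (2 * a - b) *\<^sub>R D"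
      for a b and c :: 'b
      by (simp add: scaleR_left_diff_distrib scaleR_right_distrib scaleR_2)
    have "g k = 2 *\<^sub>R g (Suc j) - g j"
      using assms(1)[of j] less.prems 3 by (simp add: eq_diff_eq)
    also have "\<dots> = 2 *\<^sub>R (g 0 + real (Suc j) *\<^sub>R D) - (g 0 + real j *\<^sub>R D)"
      using less.IH[of "Suc j"] less.IH[of j] less.prems 3 by (simp add: D_def)
    also have "\<dots> = g 0 + (2 * real (Suc j) - real j) *\<^sub>R D"
      by (rule extrapolate)
    also have "2 * real (Suc j) - real j = real k"
      using 3 by simp
    finally show ?thesis by (simp add: D_def)
  qed auto
qed

text \<open>
  The values at the multiples of \<open>1/n\<close> form an arithmetic progression as soon as \<open>1/n < \<delta>\<close>, so \<open>g\<close>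
  agrees with the affine interpolation of its end values on these grids; continuity does the rest.
\<close>

lemma locally_midpoint_affine_imp_affine:
  fixes g :: "real \<Rightarrow> 'b::real_normed_vector"
  assumes cont: "continuous_on {0..1} g" and "\<delta> > 0"
    and mid: "\<And>s \<eta>. 0 \<le> s - \<eta> \<Longrightarrow> s + \<eta> \<le> 1 \<Longrightarrow> 0 < \<eta> \<Longrightarrow> \<eta> < \<delta> \<Longrightarrow>
      g (s + \<eta>) + g (s - \<eta>) = 2 *\<^sub>R g s"
    and t: "t \<in> {0..1}"
  shows "g t = t *\<^sub>R g 1 + (1 - t) *\<^sub>R g 0"
proof -
  \<comment> \<open>The grid points \<open>k n / n\<close> approximate \<open>t\<close> from below with error less than \<open>1/n\<close>.\<close>
  define k where "k n = nat \<lfloor>t * real n\<rfloor>" for n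
  have k: "real (k n) \<le> t * real n" "t * real n < real (k n) + 1" for n
    using t by (auto simp: k_def)
  have kn: "k n \<le> n" for n
  proof -
    have "t * real n \<le> real n" using t by (simp add: mult_left_le_one_le)
    then show ?thesis using k(1)[of n] by linarith
  qed
  have lim: "(\<lambda>n. real (k n) / real n) \<longlonglongrightarrow> t"
  proof (rule tendsto_sandwich)
    show "(\<lambda>n. t - 1 / real n) \<longlonglongrightarrow> t" "(\<lambda>n. t) \<longlonglongrightarrow> t"
      using tendsto_diff[OF tendsto_const[of t] lim_1_over_n[where 'a = real]] by simp_all
    show "\<forall>\<^sub>F n in sequentially. t - 1 / real n \<le> real (k n) / real n"
      using eventually_gt_at_top[of 0]
    proof eventually_elim
      case (elim n)
      then have "t < (real (k n) + 1) / real n"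
        using k(2)[of n] by (simp add: pos_less_divide_eq)
      then show ?case by (simp add: add_divide_distrib)
    qed
    show "\<forall>\<^sub>F n in sequentially. real (k n) / real n \<le> t"
      using eventually_gt_at_top[of 0]
    proof eventually_elim
      case (elim n)
      then show ?case using k(1)[of n] by (simp add: field_simps)
    qed
  qed
  have glim: "(\<lambda>n. g (real (k n) / real n)) \<longlonglongrightarrow> g t"
  proof (rule continuous_on_tendsto_compose[OF cont lim t])
    show "\<forall>\<^sub>F n in sequentially. real (k n) / real n \<in> {0..1}"
      using eventually_gt_at_top[of 0]
      by eventually_elim (use kn in \<open>simp add: field_simps\<close>)
  qed
  have "\<forall>\<^sub>F n in sequentially. 1 / real n < \<delta>"
    using lim_1_over_n[where 'a = real] \<open>\<delta> > 0\<close> by (rule order_tendstoD(2))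
  then have "\<forall>\<^sub>F n in sequentially.
      g (real (k n) / real n) = g 0 + (real (k n) / real n) *\<^sub>R (g 1 - g 0)"
    using eventually_gt_at_top[of 0]
  proof eventually_elim
    case (elim n)
    define f where "f j = g (real j / real n)" for j
    have "f (Suc (Suc j)) + f j = 2 *\<^sub>R f (Suc j)" if "Suc j < n" for j
    proof -
      have e: "real (Suc (Suc j)) / real n = real (Suc j) / real n + 1 / real n"
        "real j / real n = real (Suc j) / real n - 1 / real n"
        using elim by (simp_all add: field_simps)
      show ?thesis
        unfolding f_def e
      proof (rule mid)
        show "0 \<le> real (Suc j) / real n - 1 / real n"
          unfolding e(2)[symmetric] by simp
        show "real (Suc j) / real n + 1 / real n \<le> 1"
          unfolding e(1)[symmetric] using that elim by (simp add: field_simps)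
      qed (use elim in auto)
    qed
    then have ap: "f j = f 0 + real j *\<^sub>R (f 1 - f 0)" if "j \<le> n" for j
      using that by (rule arithmetic_progression)
    have "f n - f 0 = real n *\<^sub>R (f 1 - f 0)"
      using ap[of n] by simp
    then have "f 1 - f 0 = (1 / real n) *\<^sub>R (f n - f 0)"
      using elim by simp
    then have "f (k n) = f 0 + (real (k n) / real n) *\<^sub>R (f n - f 0)"
      using ap[OF kn] by simp
    then show ?case using elim by (simp add: f_def)
  qed
  then have "(\<lambda>n. g (real (k n) / real n)) \<longlonglongrightarrow> g 0 + t *\<^sub>R (g 1 - g 0)"
    by (rule tendsto_cong[THEN iffD2]) (intro tendsto_intros lim)
  then have "g t = g 0 + t *\<^sub>R (g 1 - g 0)"
    using glim LIMSEQ_unique by blast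
  then show ?thesis by (simp add: algebra_simps)
qed

text \<open>
  Radius \<open>0\<close> is permitted on either side. With equal radii the lemma surrounds a segment by a tube of
  constant width; with one radius \<open>0\<close> it shows that a segment from any point of \<open>K\<close> to an interior
  point runs in the interior after its start.
\<close>

lemma convex_cball_combination:
  fixes K :: "'a::real_normed_vector set"
  assumes "convex K" "cball x r \<subseteq> K" "cball y s \<subseteq> K" "0 \<le> r" "0 \<le> s" "0 \<le> t" "t \<le> 1"
  shows "cball (t *\<^sub>R x + (1 - t) *\<^sub>R y) (t * r + (1 - t) * s) \<subseteq> K"
proof
  fix w
  define \<rho> where "\<rho> = t * r + (1 - t) * s"
  define m where "m = t *\<^sub>R x + (1 - t) *\<^sub>R y"
  assume "w \<in> cball (t *\<^sub>R x + (1 - t) *\<^sub>R y) (t * r + (1 - t) * s)"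
  then have w: "norm (w - m) \<le> \<rho>" by (simp add: \<rho>_def m_def dist_norm norm_minus_commute)
  \<comment> \<open>If \<open>\<rho> = 0\<close>, then \<open>v = 0\<close> and \<open>w = m\<close>, so the degenerate case needs no separate treatment.\<close>
  define v where "v = (w - m) /\<^sub>R \<rho>"
  have \<rho>0: "\<rho> \<ge> 0" using assms by (simp add: \<rho>_def)
  have v: "norm v \<le> 1"
    unfolding v_def norm_scaleR using w \<rho>0 by (cases "\<rho> = 0") (simp_all add: field_simps)
  have v\<rho>: "\<rho> *\<^sub>R v = w - m"
    using w by (cases "\<rho> = 0") (simp_all add: v_def)
  have "norm (r *\<^sub>R v) \<le> r" "norm (s *\<^sub>R v) \<le> s"
    using v assms by (simp_all add: mult_left_le)
  then have "x + r *\<^sub>R v \<in> K" "y + s *\<^sub>R v \<in> K"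
    using assms(2,3) by (auto simp: subset_iff dist_norm)
  then have "t *\<^sub>R (x + r *\<^sub>R v) + (1 - t) *\<^sub>R (y + s *\<^sub>R v) \<in> K"
    using assms by (intro convexD) auto
  also have "t *\<^sub>R (x + r *\<^sub>R v) + (1 - t) *\<^sub>R (y + s *\<^sub>R v) = m + \<rho> *\<^sub>R v"
    by (simp add: m_def \<rho>_def algebra_simps)
  finally show "w \<in> K" by (simp add: v\<rho>)
qed

text \<open>
  The whole segment keeps a fixed distance \<open>\<rho>\<close> from the complement of \<open>K\<close>, so midpoints are preserved
  at all its points up to the same step size.
\<close>

lemma isometry_onto_affine_along_span:
  fixes T :: "'a::real_normed_vector \<Rightarrow> 'b::real_normed_vector"
  assumes L: "convex L" and T: "isometry_onto T K L" and K: "convex K"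
    and h: "x - y \<in> span {u. straight u}"
    and xy: "x \<in> interior K" "y \<in> interior K" and t: "t \<in> {0..1}"
  shows "T (t *\<^sub>R x + (1 - t) *\<^sub>R y) = t *\<^sub>R T x + (1 - t) *\<^sub>R T y"
proof -
  obtain r s where "0 < r" "cball x r \<subseteq> K" "0 < s" "cball y s \<subseteq> K"
    using xy by (auto simp: mem_interior_cball)
  then obtain \<rho> where \<rho>: "0 < \<rho>" "cball x \<rho> \<subseteq> K" "cball y \<rho> \<subseteq> K"
    using that[of "min r s"] by (metis cball_min_Int inf.coboundedI1 inf.coboundedI2 min_less_iff_conj)
  obtain M where M: "M \<ge> 0"
    "\<And>p t. cball p (\<bar>t\<bar> * M) \<subseteq> K \<Longrightarrow>
      T (p + t *\<^sub>R (x - y)) + T (p - t *\<^sub>R (x - y)) = 2 *\<^sub>R T p"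
    using isometry_onto_midpoint_span[OF L T h] by blast
  define \<gamma> where "\<gamma> s = s *\<^sub>R x + (1 - s) *\<^sub>R y" for s
  have ball: "cball (\<gamma> s) \<rho> \<subseteq> K" if "s \<in> {0..1}" for s
    using convex_cball_combination[OF K \<rho>(2,3), of s] \<rho>(1) that
    by (simp add: \<gamma>_def algebra_simps)
  then have \<gamma>K: "\<gamma> ` {0..1} \<subseteq> K" using \<rho>(1) by fastforce
  have contT: "continuous_on K T"
    unfolding continuous_on_iff
    by (metis isometry_onto_dist[OF T])
  have "T (\<gamma> t) = t *\<^sub>R T (\<gamma> 1) + (1 - t) *\<^sub>R T (\<gamma> 0)"
  proof (rule locally_midpoint_affine_imp_affine[where g = "T \<circ> \<gamma>", unfolded o_def])
    have "continuous_on {0..1} \<gamma>" unfolding \<gamma>_def by (intro continuous_intros)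
    then show "continuous_on {0..1} (\<lambda>s. T (\<gamma> s))"
      using continuous_on_compose2[OF contT _ \<gamma>K] by blast
    show "0 < \<rho> / (M + 1)" using \<rho>(1) M(1) by simp
    fix s \<eta> :: real
    assume s: "0 \<le> s - \<eta>" "s + \<eta> \<le> 1" "0 < \<eta>" "\<eta> < \<rho> / (M + 1)"
    have "\<bar>\<eta>\<bar> * M \<le> \<rho>"
      using s(3,4) M(1) by (simp add: field_simps)
    then have "cball (\<gamma> s) (\<bar>\<eta>\<bar> * M) \<subseteq> K"
      using ball[of s] s subset_cball by fastforce
    from M(2)[OF this] show "T (\<gamma> (s + \<eta>)) + T (\<gamma> (s - \<eta>)) = 2 *\<^sub>R T (\<gamma> s)"
      by (simp add: \<gamma>_def algebra_simps)
  qed (rule t)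
  then show ?thesis by (simp add: \<gamma>_def)
qed

section \<open>Density and passage to the limit\<close>

text \<open>
  The closed span contains a ball, and differences of points of a ball, rescaled, give every vector.
\<close>

lemma closure_span_eq_UNIV:
  fixes E :: "'a::real_normed_vector set"
  assumes "interior (closure (convex hull E)) \<noteq> {}"
  shows "closure (span E) = UNIV"
proof -
  have sub: "closure (convex hull E) \<subseteq> closure (span E)"
    by (intro closure_mono convex_hull_subset_span)
  obtain c r where r: "r > 0" and c: "cball c r \<subseteq> closure (span E)"
    using assms sub by (metis all_not_in_conv mem_interior_cball subset_trans)
  have "y \<in> closure (span E)" for y
  proof (cases "y = 0")
    case True
    then show ?thesis using closure_subset span_zero by blast
  next
    case False
    define a where "a = r / norm y"
    have "c + a *\<^sub>R y \<in> closure (span E)" "c \<in> closure (span E)"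
      using c r False by (auto simp: a_def subset_iff dist_norm)
    then obtain f g where f: "\<And>n. f n \<in> span E" "f \<longlonglongrightarrow> c + a *\<^sub>R y"
      and g: "\<And>n. g n \<in> span E" "g \<longlonglongrightarrow> c"
      by (metis closure_sequential)
    have "(\<lambda>n. (1 / a) *\<^sub>R (f n - g n)) \<longlonglongrightarrow> (1 / a) *\<^sub>R (c + a *\<^sub>R y - c)"
      by (intro tendsto_intros f g)
    moreover have "(1 / a) *\<^sub>R (c + a *\<^sub>R y - c) = y"
      using r False by (simp add: a_def)
    moreover have "(1 / a) *\<^sub>R (f n - g n) \<in> span E" for n
      by (intro span_scale span_diff f g)
    ultimately show ?thesis by (metis (no_types, lifting) closure_sequential)
  qed
  then show ?thesis by blast
qed

lemma convex_subset_closure_interior: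
  fixes K :: "'a::real_normed_vector set"
  assumes "convex K" "interior K \<noteq> {}"
  shows "K \<subseteq> closure (interior K)"
proof
  fix x assume x: "x \<in> K"
  obtain z r where r: "r > 0" "cball z r \<subseteq> K"
    using assms(2) by (metis all_not_in_conv mem_interior_cball)
  define f where "f n = (1 / real (Suc n)) *\<^sub>R z + (1 - 1 / real (Suc n)) *\<^sub>R x" for n
  have "f n \<in> interior K" for n
  proof -
    have "cball (f n) ((1 / real (Suc n)) * r + (1 - 1 / real (Suc n)) * 0) \<subseteq> K"
      unfolding f_def using assms(1) r x by (intro convex_cball_combination) auto
    moreover have "(1 / real (Suc n)) * r + (1 - 1 / real (Suc n)) * 0 > 0"
      using r by simp
    ultimately show ?thesis unfolding mem_interior_cball by blast
  qed
  moreover have "f \<longlonglongrightarrow> 0 *\<^sub>R z + (1 - 0) *\<^sub>R x"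
    unfolding f_def by (intro tendsto_intros LIMSEQ_Suc[OF lim_1_over_n])
  ultimately show "x \<in> closure (interior K)"
    by (metis (no_types, lifting) add_0 closure_sequential diff_zero scaleR_one scaleR_zero_left)
qed

text \<open>
  An isometry is continuous on \<open>K\<close>, so being affine on a segment is a closed condition on its end points.
\<close>

lemma isometry_onto_affine_limit:
  fixes T :: "'a::real_normed_vector \<Rightarrow> 'b::real_normed_vector"
  assumes T: "isometry_onto T K L" and K: "convex K" and t: "t \<in> {0..1}"
    and f: "f \<longlonglongrightarrow> x" "\<And>n. f n \<in> K" "x \<in> K"
    and g: "g \<longlonglongrightarrow> y" "\<And>n. g n \<in> K" "y \<in> K"
    and ev: "\<forall>\<^sub>F n in sequentially.
      T (t *\<^sub>R f n + (1 - t) *\<^sub>R g n) = t *\<^sub>R T (f n) + (1 - t) *\<^sub>R T (g n)"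
  shows "T (t *\<^sub>R x + (1 - t) *\<^sub>R y) = t *\<^sub>R T x + (1 - t) *\<^sub>R T y"
proof -
  have T_lim: "(\<lambda>n. T (a n)) \<longlonglongrightarrow> T b" if "a \<longlonglongrightarrow> b" "\<And>n. a n \<in> K" "b \<in> K" for a b
    using that by (simp add: tendsto_dist_iff[of _ "T b"] tendsto_dist_iff[of a] isometry_onto_dist[OF T])
  have "(\<lambda>n. T (t *\<^sub>R f n + (1 - t) *\<^sub>R g n)) \<longlonglongrightarrow> T (t *\<^sub>R x + (1 - t) *\<^sub>R y)"
    by (rule T_lim) (use K t f g in \<open>auto intro!: tendsto_intros convexD\<close>)
  moreover have "(\<lambda>n. t *\<^sub>R T (f n) + (1 - t) *\<^sub>R T (g n)) \<longlonglongrightarrow> t *\<^sub>R T x + (1 - t) *\<^sub>R T y"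
    by (intro tendsto_intros T_lim f g)
  ultimately show ?thesis
    using tendsto_cong[OF ev] LIMSEQ_unique by blast
qed

theorem theorem2:
  fixes K :: "'a::banach set"
  assumes "interior (closure (convex hull {x :: 'a. x extreme_point_of cball 0 1})) \<noteq> {}"
    and "convex_body K"
  shows "strong_mankiewicz TYPE('b::real_normed_vector) K"
  unfolding strong_mankiewicz_def affine_map_on_def
proof (intro allI impI ballI, elim conjE)
  fix L :: "'b set" and T :: "'a \<Rightarrow> 'b" and x y :: 'a and t :: real
  assume L: "convex L" and T: "isometry_onto T K L" and x: "x \<in> K" and y: "y \<in> K"
    and t: "t \<in> {0..1}"
  have K: "convex K" "interior K \<noteq> {}" using assms(2) by (auto simp: convex_body_def)
  have "closure (span {u :: 'a. straight u}) = UNIV"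
    using closure_span_eq_UNIV[OF assms(1)]
      closure_mono[OF span_mono, of "{x :: 'a. x extreme_point_of cball 0 1}" "{u. straight u}"]
      straight_extreme_point by blast
  then have dense: "\<exists>h. (\<forall>n. h n \<in> span {u. straight u}) \<and> h \<longlonglongrightarrow> v" for v :: 'a
    by (metis UNIV_I closure_sequential)
  \<comment> \<open>Between interior points, move one end point slightly to give the segment a direction in the span.\<close>
  have intK: "T (t *\<^sub>R x + (1 - t) *\<^sub>R y) = t *\<^sub>R T x + (1 - t) *\<^sub>R T y"
    if x: "x \<in> interior K" and y: "y \<in> interior K" for x y
  proof -
    obtain h where h: "\<And>n. h n \<in> span {u. straight u}" "h \<longlonglongrightarrow> x - y" using dense by blast
    have lim: "(\<lambda>n. y + h n) \<longlonglongrightarrow> x" using tendsto_add[OF tendsto_const[of y] h(2)] by simp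
    then have "\<forall>\<^sub>F n in sequentially. y + h n \<in> interior K"
      using x by (intro topological_tendstoD) auto
    then obtain N where N: "\<And>n. n \<ge> N \<Longrightarrow> y + h n \<in> interior K"
      by (auto simp: eventually_sequentially)
    define f where "f n = y + h (n + N)" for n
    show ?thesis
    proof (rule isometry_onto_affine_limit[OF T K(1) t, of f _ "\<lambda>_. y"])
      show "f \<longlonglongrightarrow> x" unfolding f_def using lim by (rule LIMSEQ_ignore_initial_segment)
      have fK: "f n \<in> interior K" for n using N by (simp add: f_def)
      then show "f n \<in> K" for n using interior_subset by blast
      have "f n - y \<in> span {u. straight u}" for n using h by (simp add: f_def)
      then show "\<forall>\<^sub>F n in sequentially.
          T (t *\<^sub>R f n + (1 - t) *\<^sub>R y) = t *\<^sub>R T (f n) + (1 - t) *\<^sub>R T y"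
        using isometry_onto_affine_along_span[OF L T K(1) _ fK y t] by simp
    qed (use x y interior_subset in auto)
  qed
  have "x \<in> closure (interior K)" "y \<in> closure (interior K)"
    using x y convex_subset_closure_interior[OF K] by auto
  then obtain f g where fg: "\<And>n. f n \<in> interior K" "f \<longlonglongrightarrow> x" "\<And>n. g n \<in> interior K" "g \<longlonglongrightarrow> y"
    by (metis closure_sequential)
  show "T (t *\<^sub>R x + (1 - t) *\<^sub>R y) = t *\<^sub>R T x + (1 - t) *\<^sub>R T y"
    by (rule isometry_onto_affine_limit[OF T K(1) t fg(2) _ x fg(4) _ y])
      (use fg interior_subset intK in auto)
qed

end
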